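(* Let $G$ be the complete graph on the vertex set $\{0,1\}^2\setminus\{10\}=\{00,01,11\}$ (i.e. its edges are $\{00,01\},\{00,11\},\{01,11\}$). Then $$C_M(G)=\log_2\beta\approx 0.849,$$ where $\beta^{-1}$ is the unique positive root of the equation $x+\frac{x^2}{1-x^2}=1$.
   Context: Let $H$ be a simple graph whose vertex set is $\{0,1\}^2$, the set of ordered pairs of binary symbols (written as strings $ab$), or a subset of it, and whose edges are unordered pairs of distinct vertices. Two sequences $\mathbf{x}=(x_1,\dots,x_n),\mathbf{y}=(y_1,\dots,y_n)\in\{0,1\}^n$ are called distinguishable for $H$ if there exists $i\in\{1,\dots,n-1\}$ such that $\{x_ix_{i+1},\,y_iy_{i+1}\}$ is an edge of $H$. Let $M(H,n)$ be the largest cardinality of a set $C\subseteq\{0,1\}^n$ any two distinct elements of which are distinguishable for $H$. The Shannon–Markov capacity of $H$ is $C_M(H)=\limsup_{n\to\infty}\frac1n\log_2 M(H,n)$.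
   Formalization: The equation has two positive roots (about 0.555 and 2.247), so "unique positive root" is read as the unique root in the interval (0,1); "≈ 0.849" is stated as 0.849 ≤ log₂β < 0.850. *)

theory Defs
  imports "HOL-Analysis.Analysis"
begin

(* The binary symbols 0 and 1 are False and True; the string ab is the pair (a, b).
   A graph is a pair of a vertex set and a set of two-element edges. *)

type_synonym 'a graph = "'a set \<times> 'a set set"

definition simple_graph :: "'a graph \<Rightarrow> bool" where
  "simple_graph H \<longleftrightarrow>
     (\<forall>e \<in> snd H. \<exists>u \<in> fst H. \<exists>v \<in> fst H. u \<noteq> v \<and> e = {u, v})"

definition complete_graph :: "'a set \<Rightarrow> 'a graph" where
  "complete_graph V = (V, {{u, v} | u v. u \<in> V \<and> v \<in> V \<and> u \<noteq> v})"

(* List positions are counted from 0. Used for lists of equal length only. *)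
definition distinguishable :: "(bool \<times> bool) graph \<Rightarrow> bool list \<Rightarrow> bool list \<Rightarrow> bool" where
  "distinguishable H x y \<longleftrightarrow>
     (\<exists>i. i + 1 < length x \<and> {(x ! i, x ! (i + 1)), (y ! i, y ! (i + 1))} \<in> snd H)"

definition max_code_size :: "(bool \<times> bool) graph \<Rightarrow> nat \<Rightarrow> nat" where
  "max_code_size H n =
     Max {card C | C. C \<subseteq> {x. length x = n} \<and> pairwise (distinguishable H) C}"

definition shannon_markov_capacity :: "(bool \<times> bool) graph \<Rightarrow> ereal" where
  "shannon_markov_capacity H =
     limsup (\<lambda>n. ereal (1 / real n * log 2 (real (max_code_size H n))))"

definition G :: "(bool \<times> bool) graph" where
  "G = complete_graph (UNIV - {(True, False)})"

lemma simple_graph_complete_graph: "simple_graph (complete_graph V)"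
  by (auto simp: simple_graph_def complete_graph_def)

lemma G_vertices: "fst G = {(False, False), (False, True), (True, True)}"
  by (auto simp: G_def complete_graph_def)

lemma G_edges:
  "snd G = {{(False, False), (False, True)}, {(False, False), (True, True)},
            {(False, True), (True, True)}}"
proof -
  have complete3: "{{u, v} | u v. u \<in> {a, b, c} \<and> v \<in> {a, b, c} \<and> u \<noteq> v}
      = {{a, b}, {a, c}, {b, c}}" if "a \<noteq> b" "a \<noteq> c" "b \<noteq> c" for a b c :: "bool \<times> bool"
    using that by blast
  have "snd G = {{u, v} | u v. u \<in> fst G \<and> v \<in> fst G \<and> u \<noteq> v}"
    by (simp add: G_def complete_graph_def)
  then show ?thesis
    unfolding G_vertices by (simp only:) (rule complete3; simp)
qed

lemma finite_code_sizes:
  "finite {card C | C. C \<subseteq> {x. length x = n} \<and> pairwise (distinguishable H) C}"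
proof -
  have "finite {x :: bool list. length x = n}"
    using finite_lists_length_eq[of "UNIV :: bool set" n] by simp
  then have "finite (card ` Pow {x :: bool list. length x = n})"
    by blast
  then show ?thesis
    by (rule rev_finite_subset) auto
qed

lemma max_code_size_pos: "max_code_size H n \<ge> 1"
proof -
  have "1 \<in> {card C | C. C \<subseteq> {x. length x = n} \<and> pairwise (distinguishable H) C}"
    by (rule CollectI, rule exI[of _ "{replicate n False}"]) (simp add: pairwise_def)
  then show ?thesis
    unfolding max_code_size_def by (rule Max_ge[OF finite_code_sizes])
qed

end

theory Submission
  imports Defs
begin

text \<open>
  The extremal codes come from the set of words all of whose maximal runs of ones have odd length.
  Two such words, preceded by a common 0, are distinguishable: at the first difference either
  the previous symbol is 0 and the pairs 01, 00 separate them, or one word has just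
  closed an odd run of ones, so that the other must go on with 11.
  Conversely, turning the last 1 of every even run into 0 maps every word to this set and is
  injective on codes, because it only alters information next to an erased pair 10.
  Counting the odd-run words by a three-state automaton gives the growth rate \<open>\<beta>\<close>.
\<close>

text \<open>The argument \<open>k\<close> is the length of the run of ones immediately preceding the word.\<close>

fun odd_runs :: "nat \<Rightarrow> bool list \<Rightarrow> bool" where
  "odd_runs k [] \<longleftrightarrow> k = 0 \<or> odd k"
| "odd_runs k (True # x) \<longleftrightarrow> odd_runs (Suc k) x"
| "odd_runs k (False # x) \<longleftrightarrow> (k = 0 \<or> odd k) \<and> odd_runs 0 x"

text \<open>The lookahead at \<open>hd x\<close> detects the last 1 of a run, the end of the word
  counting as a 0. An odd \<open>k\<close> before that 1 means that the run including it is even.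
  After an erasure the counter restarts at 0, in step with the output.\<close>

fun trim_runs :: "nat \<Rightarrow> bool list \<Rightarrow> bool list" where
  "trim_runs k [] = []"
| "trim_runs k (True # x) =
     (if odd k \<and> (x = [] \<or> \<not> hd x) then False # trim_runs 0 x else True # trim_runs (Suc k) x)"
| "trim_runs k (False # x) = False # trim_runs 0 x"

definition odd_run_words :: "nat \<Rightarrow> nat \<Rightarrow> bool list set" where
  "odd_run_words k n = {x. length x = n \<and> odd_runs k x}"

section \<open>Distinguishability of odd-run words\<close>

lemma edge_G_iff:
  "{u, v} \<in> snd G \<longleftrightarrow> u \<noteq> v \<and> u \<noteq> (True, False) \<and> v \<noteq> (True, False)"
  unfolding G_def complete_graph_def by (auto simp: doubleton_eq_iff simp del: split_paired_Ex)

lemma distinguishable_Cons: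
  assumes "distinguishable H x y"
  shows "distinguishable H (a # x) (b # y)"
proof -
  from assms obtain i where
    "i + 1 < length x" "{(x ! i, x ! (i + 1)), (y ! i, y ! (i + 1))} \<in> snd H"
    unfolding distinguishable_def by blast
  then show ?thesis
    unfolding distinguishable_def by (intro exI[of _ "Suc i"]) simp
qed

lemma distinguishable_sym:
  assumes "length x = length y" "distinguishable H x y"
  shows "distinguishable H y x"
  using assms unfolding distinguishable_def by (simp add: insert_commute)

text \<open>The symbol \<open>0 < k\<close> is the one just before the difference: 1 exactly when a
  run is open. It supplies the left half of the first pair.\<close>

lemma distinguishable_first_difference:
  assumes "odd_runs k (True # x)" "odd_runs k (False # y)" "length x = length y"
  shows "distinguishable G ((0 < k) # True # x) ((0 < k) # False # y)"
proof (cases "k = 0")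
  case True
  then show ?thesis
    unfolding distinguishable_def by (intro exI[of _ 0]) (simp add: edge_G_iff)
next
  case False
  with assms(2) have "odd k" by simp
  with assms(1) obtain x' where x: "x = True # x'"
    by (cases "(Suc k, x)" rule: odd_runs.cases) auto
  with assms(3) obtain b y' where y: "y = b # y'" by (cases y) auto
  \<comment> \<open>At position 0 the second word reads 10, which is no vertex; position 1 compares
    11 with 0b, distinct for either value of \<open>b\<close>.\<close>
  show ?thesis
    unfolding distinguishable_def x y by (intro exI[of _ 1]) (simp add: edge_G_iff)
qed

lemma odd_runs_distinguishable:
  assumes "odd_runs k x" "odd_runs k y" "length x = length y" "x \<noteq> y"
  shows "distinguishable G ((0 < k) # x) ((0 < k) # y)"
  using assms
proof (induction x arbitrary: k y)
  case Nil
  then show ?case by simp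
next
  case (Cons a x)
  from Cons.prems(3) obtain c y' where y: "y = c # y'" by (cases y) auto
  have len: "length x = length y'" using Cons.prems y by simp
  consider "a" "c" | "\<not> a" "\<not> c" | "a" "\<not> c" | "\<not> a" "c" by blast
  then show ?case
  proof cases
    case 1
    have "distinguishable G ((0 < Suc k) # x) ((0 < Suc k) # y')"
      using 1 Cons.prems y by (intro Cons.IH) auto
    with 1 y show ?thesis
      by (simp add: distinguishable_Cons)
  next
    case 2
    have "distinguishable G ((0 < (0::nat)) # x) ((0 < (0::nat)) # y')"
      using 2 Cons.prems y by (intro Cons.IH) auto
    with 2 y show ?thesis
      by (simp add: distinguishable_Cons)
  next
    case 3
    with Cons.prems y len show ?thesis
      using distinguishable_first_difference[of k x y'] by auto
  next
    case 4
    then have "distinguishable G ((0 < k) # y) ((0 < k) # a # x)"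
      using distinguishable_first_difference[of k y' x] Cons.prems y len by auto
    then show ?thesis
      by (rule distinguishable_sym[rotated]) (simp add: y len)
  qed
qed

section \<open>Trimming even runs\<close>

lemma length_trim_runs [simp]: "length (trim_runs k x) = length x"
  by (induction k x rule: trim_runs.induct) auto

text \<open>The hypothesis excludes an even open run that ends at once, since trimming cannot reach
  back before the word. The lookahead preserves it: an odd run is extended only if a further 1
  follows.\<close>

lemma odd_runs_trim_runs:
  assumes "k = 0 \<or> odd k \<or> (x \<noteq> [] \<and> hd x)"
  shows "odd_runs k (trim_runs k x)"
  using assms by (induction k x rule: trim_runs.induct) auto

lemma trim_runs_le:
  assumes "i < length x" "trim_runs k x ! i"
  shows "x ! i"
  using assms
proof (induction k x arbitrary: i rule: trim_runs.induct)
  case (2 k x)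
  then show ?case by (cases i) (auto split: if_splits)
next
  case (3 k x)
  then show ?case by (cases i) auto
qed simp

text \<open>An erased 1 ends an even run, so a kept 1 stands before it. For \<open>i = 0\<close>
  that 1 lies before the word and shows only in the parity of \<open>k\<close>.\<close>

lemma trim_runs_changed:
  assumes "i < length x" "x ! i" "\<not> trim_runs k x ! i"
  shows "(Suc i < length x \<longrightarrow> \<not> x ! Suc i) \<and> (if i = 0 then odd k else trim_runs k x ! (i - 1))"
  using assms
proof (induction k x arbitrary: i rule: trim_runs.induct)
  case (2 k x)
  show ?case
  proof (cases i)
    case 0
    with "2.prems" show ?thesis by (auto split: if_splits simp: hd_conv_nth)
  next
    case (Suc j)
    show ?thesis
    proof (cases "odd k \<and> (x = [] \<or> \<not> hd x)")
      case True
      with "2.IH"(1)[OF True, of j] "2.prems" Suc show ?thesis by (cases j) auto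
    next
      case False
      with "2.IH"(2)[OF False, of j] "2.prems" Suc show ?thesis by (cases j) auto
    qed
  qed
next
  case (3 k x)
  show ?case
  proof (cases i)
    case 0
    with "3.prems" show ?thesis by simp
  next
    case (Suc j)
    with "3.IH"[of j] "3.prems" show ?thesis by (cases j) auto
  qed
qed simp

text \<open>A pair other than 10 can be read off the trimmed word: 00 and 01 are unchanged, and 11
  becomes 11 or 10.\<close>

lemma trim_runs_separates:
  assumes "length x = length y" "distinguishable G x y"
  shows "trim_runs 0 x \<noteq> trim_runs 0 y"
proof
  assume eq: "trim_runs 0 x = trim_runs 0 y"
  from assms(2) obtain i where i: "Suc i < length x"
    and e: "(x ! i, x ! Suc i) \<noteq> (y ! i, y ! Suc i)"
      "(x ! i, x ! Suc i) \<noteq> (True, False)" "(y ! i, y ! Suc i) \<noteq> (True, False)"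
    unfolding distinguishable_def edge_G_iff by auto
  \<comment> \<open>If \<open>u ! i\<close> is 1, the pair is 11 and its first 1 survives, so
    \<open>v\<close> has 1 there and hence also 11. Otherwise the pair is 01; erasing its 1 would
    require a 1 before it in the trimmed word, so it survives and \<open>v\<close> has it
    too.\<close>
  have same: "u ! i = v ! i \<and> u ! Suc i = v ! Suc i"
    if "u ! i \<or> u ! Suc i \<and> u ! i = v ! i" "Suc i < length u" "length u = length v"
      "trim_runs 0 u = trim_runs 0 v"
      "(u ! i, u ! Suc i) \<noteq> (True, False)" "(v ! i, v ! Suc i) \<noteq> (True, False)" for u v
    using that trim_runs_changed[of i u 0] trim_runs_changed[of "Suc i" u 0]
      trim_runs_le[of i v 0] trim_runs_le[of "Suc i" v 0]
    by (auto split: if_splits)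
  have i': "Suc i < length y" using i assms(1) by simp
  consider "x ! i \<or> x ! Suc i \<and> x ! i = y ! i" | "y ! i \<or> y ! Suc i \<and> y ! i = x ! i"
    using e(1) by auto
  then show False
  proof cases
    case 1
    from same[OF 1 i assms(1) eq e(2,3)] e(1) show False by simp
  next
    case 2
    from same[OF 2 i' assms(1)[symmetric] eq[symmetric] e(3,2)] e(1) show False by simp
  qed
qed

section \<open>Code sizes against odd-run words\<close>

lemma finite_odd_run_words [simp]: "finite (odd_run_words k n)"
proof (rule finite_subset)
  show "odd_run_words k n \<subseteq> {x. set x \<subseteq> UNIV \<and> length x = n}"
    unfolding odd_run_words_def by blast
  show "finite {x :: bool list. set x \<subseteq> UNIV \<and> length x = n}"
    by (rule finite_lists_length_eq) simp
qed

lemma max_code_size_le: "max_code_size G n \<le> card (odd_run_words 0 n)"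
  unfolding max_code_size_def
proof (rule Max.boundedI[OF finite_code_sizes], goal_cases)
  case 1
  have "pairwise (distinguishable G) {}" by simp
  then show ?case by blast
next
  case (2 c)
  then obtain C where C: "C \<subseteq> {x. length x = n}" "pairwise (distinguishable G) C" "c = card C"
    by blast
  have "inj_on (trim_runs 0) C"
  proof (rule inj_onI, rule ccontr)
    fix x y assume xy: "x \<in> C" "y \<in> C" "trim_runs 0 x = trim_runs 0 y" "x \<noteq> y"
    then have "distinguishable G x y" "length x = length y"
      using C by (auto simp: pairwise_def)
    with trim_runs_separates xy(3) show False by blast
  qed
  moreover have "trim_runs 0 ` C \<subseteq> odd_run_words 0 n"
    using C(1) by (auto simp: odd_run_words_def odd_runs_trim_runs)
  ultimately have "card C \<le> card (odd_run_words 0 n)"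
    by (rule card_inj_on_le) simp
  with C(3) show ?case by simp
qed

lemma max_code_size_ge: "card (odd_run_words 0 n) \<le> max_code_size G (Suc n)"
proof -
  \<comment> \<open>The leading 0 is the symbol \<open>0 < k\<close> for \<open>k = 0\<close>; it
    costs one position.\<close>
  let ?C = "(#) False ` odd_run_words 0 n"
  have "pairwise (distinguishable G) ?C"
    using odd_runs_distinguishable[of 0] by (auto simp: pairwise_def odd_run_words_def)
  moreover have "?C \<subseteq> {x. length x = Suc n}"
    by (auto simp: odd_run_words_def)
  ultimately have "card ?C \<le> max_code_size G (Suc n)"
    unfolding max_code_size_def
    by (intro Max_ge[OF finite_code_sizes] CollectI exI[of _ ?C] conjI refl)
  then show ?thesis by (simp add: card_image)
qed

section \<open>Growth of the number of odd-run words\<close>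

lemma card_odd_run_words_0: "card (odd_run_words k 0) = (if k = 0 \<or> odd k then 1 else 0)"
proof -
  have "odd_run_words k 0 = (if k = 0 \<or> odd k then {[]} else {})"
    by (auto simp: odd_run_words_def)
  then show ?thesis by simp
qed

lemma card_odd_run_words_Suc:
  "card (odd_run_words k (Suc n)) =
     card (odd_run_words (Suc k) n) + (if k = 0 \<or> odd k then card (odd_run_words 0 n) else 0)"
proof -
  let ?F = "if k = 0 \<or> odd k then (#) False ` odd_run_words 0 n else {}"
  have "odd_run_words k (Suc n) = (#) True ` odd_run_words (Suc k) n \<union> ?F"
  proof (rule set_eqI)
    fix x
    show "x \<in> odd_run_words k (Suc n) \<longleftrightarrow> x \<in> (#) True ` odd_run_words (Suc k) n \<union> ?F"
    proof (cases x)
      case (Cons a y)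
      then show ?thesis by (cases a) (auto simp: odd_run_words_def)
    qed (auto simp: odd_run_words_def)
  qed
  then have "card (odd_run_words k (Suc n)) = card ((#) True ` odd_run_words (Suc k) n) + card ?F"
    by (simp only:) (rule card_Un_disjoint; auto)
  then show ?thesis by (simp add: card_image)
qed

text \<open>The \<open>\<beta>\<close>-eigenvector of the automaton recognising the words with odd runs.\<close>

definition run_weight :: "real \<Rightarrow> nat \<Rightarrow> real" where
  "run_weight \<beta> k = (if k = 0 then 1 else if odd k then \<beta> - 1 else (\<beta> - 1) / \<beta>)"

text \<open>For \<open>k = 0\<close> and for positive even \<open>k\<close> this is an identity; the
  cubic is exactly the condition at odd \<open>k\<close>.\<close>

lemma run_weight_Suc:
  assumes "\<beta> ^ 3 - \<beta>\<^sup>2 - 2 * \<beta> + 1 = 0" "\<beta> > 0"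
  shows "\<beta> * run_weight \<beta> k = run_weight \<beta> (Suc k) + (if k = 0 \<or> odd k then run_weight \<beta> 0 else 0)"
proof -
  have "\<beta> * (\<beta> - 1) = (\<beta> - 1) / \<beta> + 1"
    using assms by (simp add: field_simps power2_eq_square power3_eq_cube)
  then show ?thesis
    using assms(2) by (auto simp: run_weight_def simp flip: \<open>\<beta> * (\<beta> - 1) = (\<beta> - 1) / \<beta> + 1\<close>)
qed

text \<open>The factor \<open>\<beta> - 1\<close> is the smaller weight of the two accepting states
  (\<open>k = 0\<close> and odd \<open>k\<close>), which settles length 0; the eigenvector equation
  carries the bound on.\<close>

lemma card_odd_run_words_le:
  fixes \<beta> :: real
  assumes "\<beta> ^ 3 - \<beta>\<^sup>2 - 2 * \<beta> + 1 = 0" "1 < \<beta>" "\<beta> < 2"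
  shows "(\<beta> - 1) * card (odd_run_words k n) \<le> run_weight \<beta> k * \<beta> ^ n"
proof (induction n arbitrary: k)
  case 0
  then show ?case
    using assms by (simp add: card_odd_run_words_0 run_weight_def)
next
  case (Suc n)
  have "run_weight \<beta> k * \<beta> ^ Suc n = (\<beta> * run_weight \<beta> k) * \<beta> ^ n" by simp
  also have "\<dots> = run_weight \<beta> (Suc k) * \<beta> ^ n +
      (if k = 0 \<or> odd k then run_weight \<beta> 0 * \<beta> ^ n else 0)"
    using run_weight_Suc[OF assms(1), of k] assms(2) by (simp add: distrib_right)
  finally show ?case
    using Suc[of "Suc k"] Suc[of 0] by (simp add: card_odd_run_words_Suc distrib_left)
qed

text \<open>The count is taken one symbol later because at length 0 a positive even \<open>k\<close>
  has no words but positive weight. At length 1 every state has a word, and all weights are at most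
  1.\<close>

lemma card_odd_run_words_ge:
  fixes \<beta> :: real
  assumes "\<beta> ^ 3 - \<beta>\<^sup>2 - 2 * \<beta> + 1 = 0" "1 < \<beta>" "\<beta> < 2"
  shows "run_weight \<beta> k * \<beta> ^ n \<le> card (odd_run_words k (Suc n))"
proof (induction n arbitrary: k)
  case 0
  then show ?case
    using assms by (simp add: card_odd_run_words_Suc card_odd_run_words_0 run_weight_def)
next
  case (Suc n)
  have "run_weight \<beta> k * \<beta> ^ Suc n = (\<beta> * run_weight \<beta> k) * \<beta> ^ n" by simp
  also have "\<dots> = run_weight \<beta> (Suc k) * \<beta> ^ n +
      (if k = 0 \<or> odd k then run_weight \<beta> 0 * \<beta> ^ n else 0)"
    using run_weight_Suc[OF assms(1), of k] assms(2) by (simp add: distrib_right)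
  finally show ?case
    using Suc[of "Suc k"] Suc[of 0] by (simp add: card_odd_run_words_Suc[of k "Suc n"])
qed

section \<open>The capacity as a limit\<close>

lemma shannon_markov_capacity_G:
  fixes \<beta> :: real
  assumes "\<beta> ^ 3 - \<beta>\<^sup>2 - 2 * \<beta> + 1 = 0" "1 < \<beta>" "\<beta> < 2"
  shows "shannon_markov_capacity G = ereal (log 2 \<beta>)"
proof -
  define M where "M n = real (max_code_size G n)" for n
  have M_pos: "M n \<ge> 1" for n
    using max_code_size_pos[of G n] by (simp add: M_def)
  have upper: "log 2 (M n) \<le> real n * log 2 \<beta> - log 2 (\<beta> - 1)" for n
  proof -
    have "(\<beta> - 1) * M n \<le> (\<beta> - 1) * card (odd_run_words 0 n)"
      using max_code_size_le[of n] assms by (simp add: M_def)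
    also have "\<dots> \<le> \<beta> ^ n"
      using card_odd_run_words_le[OF assms, of 0 n] by (simp add: run_weight_def)
    finally have "log 2 ((\<beta> - 1) * M n) \<le> log 2 (\<beta> ^ n)"
      using assms M_pos[of n] by (intro log_mono) auto
    then show ?thesis
      using assms M_pos[of n] by (simp add: log_mult log_nat_power)
  qed
  have lower: "real n * log 2 \<beta> - 2 * log 2 \<beta> \<le> log 2 (M n)" if "n \<ge> 2" for n
  proof -
    \<comment> \<open>One symbol goes to the leading 0 of the code, one to the shift in the lower
      count.\<close>
    obtain m where n: "n = Suc (Suc m)"
      using \<open>n \<ge> 2\<close> by (metis add_2_eq_Suc le_Suc_ex)
    have "\<beta> ^ m \<le> card (odd_run_words 0 (Suc m))"
      using card_odd_run_words_ge[OF assms, of 0 m] by (simp add: run_weight_def)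
    also have "\<dots> \<le> M n"
      using max_code_size_ge[of "Suc m"] by (simp add: M_def n)
    finally have "log 2 (\<beta> ^ m) \<le> log 2 (M n)"
      using assms by (intro log_mono) auto
    then show ?thesis
      using assms by (simp add: log_nat_power n algebra_simps)
  qed
  have lim: "(\<lambda>n. log 2 \<beta> - c / real n) \<longlonglongrightarrow> log 2 \<beta>" for c
    using tendsto_diff[OF tendsto_const lim_const_over_n[of c]] by simp
  have "(\<lambda>n. 1 / real n * log 2 (M n)) \<longlonglongrightarrow> log 2 \<beta>"
  proof (rule tendsto_sandwich[OF _ _ lim[of "2 * log 2 \<beta>"] lim[of "log 2 (\<beta> - 1)"]])
    show "\<forall>\<^sub>F n in sequentially. log 2 \<beta> - 2 * log 2 \<beta> / real n \<le> 1 / real n * log 2 (M n)"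
      using eventually_ge_at_top[of 2]
    proof eventually_elim
      case (elim n)
      then have "(real n * log 2 \<beta> - 2 * log 2 \<beta>) / real n \<le> log 2 (M n) / real n"
        using lower[of n] by (intro divide_right_mono) auto
      with elim show ?case by (simp add: diff_divide_distrib)
    qed
    show "\<forall>\<^sub>F n in sequentially. 1 / real n * log 2 (M n) \<le> log 2 \<beta> - log 2 (\<beta> - 1) / real n"
      using eventually_ge_at_top[of 1]
    proof eventually_elim
      case (elim n)
      have "log 2 (M n) / real n \<le> (real n * log 2 \<beta> - log 2 (\<beta> - 1)) / real n"
        using upper[of n] by (intro divide_right_mono) auto
      with elim show ?case by (simp add: diff_divide_distrib)
    qed
  qed
  then show ?thesis
    unfolding shannon_markov_capacity_def M_def
    by (intro lim_imp_Limsup) auto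
qed

section \<open>The root equation\<close>

text \<open>Multiply by the nonzero \<open>1 - x\<^sup>2\<close>. The resulting cubic has the
  coefficients of the cubic for \<beta> in reverse order.\<close>

lemma root_equation_iff:
  fixes x :: real
  assumes "0 < x" "x < 1"
  shows "x + x\<^sup>2 / (1 - x\<^sup>2) = 1 \<longleftrightarrow> x ^ 3 - 2 * x\<^sup>2 - x + 1 = 0"
proof -
  have "x\<^sup>2 < 1"
    using assms by (simp add: power_less_one_iff)
  then show ?thesis
    by (simp add: field_simps power2_eq_square power3_eq_cube)
qed

lemma root_unique:
  fixes x y :: real
  assumes "0 < x" "x < 1" "0 < y" "y < 1"
    and "x ^ 3 - 2 * x\<^sup>2 - x + 1 = 0" "y ^ 3 - 2 * y\<^sup>2 - y + 1 = 0"
  shows "x = y"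
proof -
  \<comment> \<open>The difference of the two cubics, factored. On the unit interval the second
    factor is below \<open>- y - 1\<close>, so the first must vanish.\<close>
  have "(x - y) * (x * x + x * y + y * y - 2 * x - 2 * y - 1) = 0"
    using assms(5,6) by (simp add: algebra_simps power2_eq_square power3_eq_cube)
  moreover have "x * x < x" "x * y < x" "y * y < y"
    using assms by (simp_all add: mult_less_cancel_left1 mult_less_cancel_left2)
  then have "x * x + x * y + y * y - 2 * x - 2 * y - 1 < 0"
    using assms by linarith
  ultimately show ?thesis by simp
qed

lemma root_exists: "\<exists>x::real. 0 < x \<and> x < 1 \<and> x ^ 3 - 2 * x\<^sup>2 - x + 1 = 0"
proof -
  have "\<exists>x::real. 0 \<le> x \<and> x \<le> 1 \<and> x ^ 3 - 2 * x\<^sup>2 - x + 1 = 0"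
    \<comment> \<open>The cubic is 1 at 0 and -1 at 1.\<close>
    by (rule IVT2') (auto intro!: continuous_intros)
  then obtain x :: real where "0 \<le> x" "x \<le> 1" "x ^ 3 - 2 * x\<^sup>2 - x + 1 = 0" by blast
  moreover from this have "x \<noteq> 0" "x \<noteq> 1" by auto
  ultimately show ?thesis by (intro exI[of _ x]) auto
qed

section \<open>Numerical bounds\<close>

text \<open>The quadratic factor of the difference is at least \<open>b * b - 2\<close>, positive
  from 3/2 on. Only \<open>b\<close> is kept away from 1, near which the cubic decreases.\<close>

lemma cubic_strict_mono:
  fixes a b :: real
  assumes "1 \<le> a" "a < b" "3 / 2 \<le> b"
  shows "a ^ 3 - a\<^sup>2 - 2 * a < b ^ 3 - b\<^sup>2 - 2 * b"
proof -
  have "a * 1 \<le> a * a" "1 * b \<le> a * b" "3 / 2 * (3 / 2) \<le> b * b"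
    using assms by (intro mult_mono; simp)+
  then have "0 < (b - a) * (a * a + a * b + b * b - a - b - 2)"
    using assms by (intro mult_pos_pos) linarith+
  then show ?thesis
    by (simp add: algebra_simps power2_eq_square power3_eq_cube)
qed

text \<open>The cubic is negative at 1.8015 and positive at 1.8022; monotonicity places \<beta>
  between.\<close>

lemma beta_bounds:
  fixes \<beta> :: real
  assumes "\<beta> ^ 3 - \<beta>\<^sup>2 - 2 * \<beta> + 1 = 0" "1 < \<beta>"
  shows "18015 / 10000 < \<beta>" "\<beta> < 18022 / 10000"
proof -
  show "18015 / 10000 < \<beta>"
  proof (rule ccontr)
    assume "\<not> 18015 / 10000 < \<beta>"
    then consider "\<beta> < 18015 / 10000" | "\<beta> = 18015 / 10000" by linarith
    then show False
    proof cases
      case 1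
      from cubic_strict_mono[OF _ this] assms show False
        by (simp add: power2_eq_square power3_eq_cube)
    next
      case 2
      with assms(1) show False by (simp add: power2_eq_square power3_eq_cube)
    qed
  qed
  show "\<beta> < 18022 / 10000"
  proof (rule ccontr)
    assume "\<not> \<beta> < 18022 / 10000"
    then consider "18022 / 10000 < \<beta>" | "\<beta> = 18022 / 10000" by linarith
    then show False
    proof cases
      case 1
      from cubic_strict_mono[OF _ this] 1 assms show False
        by (simp add: power2_eq_square power3_eq_cube)
    next
      case 2
      with assms(1) show False by (simp add: power2_eq_square power3_eq_cube)
    qed
  qed
qed

lemma log_beta_bounds:
  fixes \<beta> :: real
  assumes "18015 / 10000 < \<beta>" "\<beta> < 18022 / 10000"
  shows "849 / 1000 \<le> log 2 \<beta>" "log 2 \<beta> < 850 / 1000"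
proof -
  \<comment> \<open>The fraction 45/53 lies between 0.849 and the binary logarithm of 1.8015; below,
    17/20 is 0.85 itself.\<close>
  have "(2::real) ^ 45 \<le> (18015 / 10000) ^ 53"
    by (simp add: power_divide)
  also have "\<dots> \<le> \<beta> ^ 53"
    using assms by (intro power_mono) auto
  finally have "log 2 (2 ^ 45) \<le> log 2 (\<beta> ^ 53)"
    using assms by (intro log_mono) auto
  then have "45 \<le> 53 * log 2 \<beta>"
    using assms by (simp only: log_nat_power) simp
  then show "849 / 1000 \<le> log 2 \<beta>" by simp
  have "\<beta> ^ 20 < (18022 / 10000) ^ 20"
    using assms by (intro power_strict_mono) auto
  also have "\<dots> \<le> (2::real) ^ 17"
    by (simp add: power_divide)
  finally have "log 2 (\<beta> ^ 20) < log 2 (2 ^ 17)"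
    using assms by (intro log_less) auto
  then have "20 * log 2 \<beta> < 17"
    using assms by (simp only: log_nat_power) simp
  then show "log 2 \<beta> < 850 / 1000" by simp
qed

text \<open>Uniqueness is claimed below 1 because the equation has a second positive root near
  2.247, where the series behind the fraction diverges. The decimal 0.849 is read as truncated: the
  value is about 0.84955.\<close>

theorem theorem2:
  shows "(\<exists>!x::real. 0 < x \<and> x < 1 \<and> x + x\<^sup>2 / (1 - x\<^sup>2) = 1) \<and>
    (\<forall>\<beta>::real. 0 < inverse \<beta> \<and> inverse \<beta> < 1 \<and>
        inverse \<beta> + (inverse \<beta>)\<^sup>2 / (1 - (inverse \<beta>)\<^sup>2) = 1 \<longrightarrow>
      shannon_markov_capacity G = ereal (log 2 \<beta>) \<and>
      849 / 1000 \<le> log 2 \<beta> \<and> log 2 \<beta> < 850 / 1000)"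
proof (intro conjI allI impI)
  obtain r :: real where r: "0 < r" "r < 1" "r ^ 3 - 2 * r\<^sup>2 - r + 1 = 0"
    using root_exists by blast
  show "\<exists>!x::real. 0 < x \<and> x < 1 \<and> x + x\<^sup>2 / (1 - x\<^sup>2) = 1"
  proof (rule ex1I)
    show "0 < r \<and> r < 1 \<and> r + r\<^sup>2 / (1 - r\<^sup>2) = 1"
      using r root_equation_iff[of r] by simp
  next
    fix x :: real assume x: "0 < x \<and> x < 1 \<and> x + x\<^sup>2 / (1 - x\<^sup>2) = 1"
    then have "x ^ 3 - 2 * x\<^sup>2 - x + 1 = 0"
      using root_equation_iff[of x] by simp
    with x r show "x = r"
      using root_unique[of x r] by simp
  qed
next
  fix \<beta> :: real
  assume a: "0 < inverse \<beta> \<and> inverse \<beta> < 1 \<and>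
    inverse \<beta> + (inverse \<beta>)\<^sup>2 / (1 - (inverse \<beta>)\<^sup>2) = 1"
  then have \<beta>: "0 < \<beta>" by simp
  with a have gt: "1 < \<beta>" by (simp add: inverse_less_1_iff)
  have "inverse \<beta> ^ 3 - 2 * (inverse \<beta>)\<^sup>2 - inverse \<beta> + 1 = 0"
    using a root_equation_iff[of "inverse \<beta>"] by simp
  \<comment> \<open>With this relation \<open>algebra\<close> can multiply the cubic by the third
    power of \<beta>, reversing its coefficients.\<close>
  moreover have "\<beta> * inverse \<beta> = 1" using \<beta> by simp
  ultimately have cubic: "\<beta> ^ 3 - \<beta>\<^sup>2 - 2 * \<beta> + 1 = 0" by algebra
  note bounds = beta_bounds[OF cubic gt]
  show "shannon_markov_capacity G = ereal (log 2 \<beta>)"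
    using shannon_markov_capacity_G[OF cubic gt] bounds by simp
  show "849 / 1000 \<le> log 2 \<beta>" "log 2 \<beta> < 850 / 1000"
    using log_beta_bounds[OF bounds] by simp_all
qed

end
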